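(* (i) Let $F$ be a field whose characteristic is not $2$ and let $\mathbb{A}$ be a left (resp. right) alternative quadratic algebra over $F$ with the property that the algebra generated by any nonzero element of $\mathbb{A}$ has no nontrivial zero-divisors. Then $\mathbb{A}$ is isomorphic to one of the following algebras over $F$: the field $F$; a field extension of degree $2$ over $F$; a quaternion algebra over $F$; an octonion algebra over $F$. (ii) Let $F$ be a field whose characteristic is not $2$ and let $\mathbb{A}$ be a flexible algebra over $F$ with a left (resp. right) identity element $e$ and with no nontrivial zero-divisors. Let $\langle\cdot,\cdot\rangle$ be a nondegenerate bilinear form on $\mathbb{A}$ that permits composition. Then $\mathbb{A}$ is isomorphic to one of the following algebras over $F$: the field $F$; a field extension of degree $2$ over $F$; a quaternion algebra over $F$; an octonion algebra over $F$.
   Context: Algebras over a field $F$ are nonzero and not necessarily associative, commutative, unital or finite-dimensional. An algebra is left (resp. right) alternative if $a(ab)=(aa)b$ (resp. $a(bb)=(ab)b$) for all $a,b$; flexible if $(ab)a=a(ba)$ for all $a,b$. A left (resp. right) identity element is $e$ with $ea=a$ (resp. $ae=a$) for all $a$. A unital algebra is quadratic if the unital subalgebra generated by any element is at most two-dimensional. A zero-divisor is an element $a$ with $ab=0$ or $ba=0$ for some $b\neq0$; zero is the trivial one. Nondegenerate bilinear forms $\langle\cdot,\cdot\rangle:\mathbb{A}\times\mathbb{A}\to F$ are by definition symmetric, with $\langle a,b\rangle=0$ for all $b$ implying $a=0$. The form permits composition if $\langle ab,ab\rangle=\langle a,a\rangle\langle b,b\rangle$ for all $a,b\in\mathbb{A}$.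 A quaternion algebra over $F$ is the four-dimensional associative algebra with basis $1,p,q,pq$ with $p^2,q^2\in F1\setminus\{0\}$ and $pq=-qp$. An octonion algebra over $F$ is the eight-dimensional alternative algebra obtained from a quaternion algebra $Q$ over $F$ by the Cayley–Dickson doubling process, i.e. $Q\oplus Q$ with product $(a,b)(c,d)=(ac+\gamma d^*b,\,da+bc^* )$ for some nonzero $\gamma\in F$, where $*$ is the standard involution of $Q$. *)

theory Defs
  imports "HOL-Analysis.Analysis"
begin

locale nonassoc_algebra = vector_space smul
  for smul :: "'f::field \<Rightarrow> 'a::ab_group_add \<Rightarrow> 'a" +
  fixes mul :: "'a \<Rightarrow> 'a \<Rightarrow> 'a"
  assumes mul_add_left: "mul (a + b) c = mul a c + mul b c"
    and mul_add_right: "mul a (b + c) = mul a b + mul a c"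
    and mul_smul_left: "mul (smul r a) b = smul r (mul a b)"
    and mul_smul_right: "mul a (smul r b) = smul r (mul a b)"
    and nonzero_algebra: "\<exists>a::'a. a \<noteq> 0"

definition left_alternative :: "('a \<Rightarrow> 'a \<Rightarrow> 'a) \<Rightarrow> bool" where
  "left_alternative mul \<longleftrightarrow> (\<forall>a b. mul a (mul a b) = mul (mul a a) b)"

definition right_alternative :: "('a \<Rightarrow> 'a \<Rightarrow> 'a) \<Rightarrow> bool" where
  "right_alternative mul \<longleftrightarrow> (\<forall>a b. mul a (mul b b) = mul (mul a b) b)"

definition flexible :: "('a \<Rightarrow> 'a \<Rightarrow> 'a) \<Rightarrow> bool" where
  "flexible mul \<longleftrightarrow> (\<forall>a b. mul (mul a b) a = mul a (mul b a))"

definition associative :: "('a \<Rightarrow> 'a \<Rightarrow> 'a) \<Rightarrow> bool" where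
  "associative mul \<longleftrightarrow> (\<forall>a b c. mul (mul a b) c = mul a (mul b c))"

definition commutative :: "('a \<Rightarrow> 'a \<Rightarrow> 'a) \<Rightarrow> bool" where
  "commutative mul \<longleftrightarrow> (\<forall>a b. mul a b = mul b a)"

definition left_identity :: "('a \<Rightarrow> 'a \<Rightarrow> 'a) \<Rightarrow> 'a \<Rightarrow> bool" where
  "left_identity mul e \<longleftrightarrow> (\<forall>a. mul e a = a)"

definition right_identity :: "('a \<Rightarrow> 'a \<Rightarrow> 'a) \<Rightarrow> 'a \<Rightarrow> bool" where
  "right_identity mul e \<longleftrightarrow> (\<forall>a. mul a e = a)"

definition two_sided_identity :: "('a \<Rightarrow> 'a \<Rightarrow> 'a) \<Rightarrow> 'a \<Rightarrow> bool" where
  "two_sided_identity mul e \<longleftrightarrow> left_identity mul e \<and> right_identity mul e"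

definition subalgebra ::
  "('f::field \<Rightarrow> 'a::ab_group_add \<Rightarrow> 'a) \<Rightarrow> ('a \<Rightarrow> 'a \<Rightarrow> 'a) \<Rightarrow> 'a set \<Rightarrow> bool" where
  "subalgebra smul mul S \<longleftrightarrow>
     module.subspace smul S \<and> (\<forall>a\<in>S. \<forall>b\<in>S. mul a b \<in> S)"

definition generated_subalgebra ::
  "('f::field \<Rightarrow> 'a::ab_group_add \<Rightarrow> 'a) \<Rightarrow> ('a \<Rightarrow> 'a \<Rightarrow> 'a) \<Rightarrow> 'a set \<Rightarrow> 'a set" where
  "generated_subalgebra smul mul S = subalgebra smul mul hull S"

(* Dimension at most two is spelled out through a finite spanning set, because
   the library's dim is 0 on infinite-dimensional spaces. *)
definition quadratic_algebra ::
  "('f::field \<Rightarrow> 'a::ab_group_add \<Rightarrow> 'a) \<Rightarrow> ('a \<Rightarrow> 'a \<Rightarrow> 'a) \<Rightarrow> bool" where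
  "quadratic_algebra smul mul \<longleftrightarrow>
     nonassoc_algebra smul mul \<and>
     (\<exists>e. two_sided_identity mul e \<and>
       (\<forall>a. \<exists>B. finite B \<and> card B \<le> 2 \<and>
          generated_subalgebra smul mul {e, a} \<subseteq> module.span smul B))"

(* Zero-divisors of the subalgebra S itself: the cofactor is taken in S. *)
definition zero_divisor_in ::
  "('a::zero \<Rightarrow> 'a \<Rightarrow> 'a) \<Rightarrow> 'a set \<Rightarrow> 'a \<Rightarrow> bool" where
  "zero_divisor_in mul S a \<longleftrightarrow>
     a \<in> S \<and> (\<exists>b\<in>S. b \<noteq> 0 \<and> (mul a b = 0 \<or> mul b a = 0))"

definition no_nontrivial_zero_divisors ::
  "('a::zero \<Rightarrow> 'a \<Rightarrow> 'a) \<Rightarrow> 'a set \<Rightarrow> bool" where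
  "no_nontrivial_zero_divisors mul S \<longleftrightarrow> (\<forall>a. zero_divisor_in mul S a \<longrightarrow> a = 0)"

definition nondegenerate_bilinear_form ::
  "('f::field \<Rightarrow> 'a::ab_group_add \<Rightarrow> 'a) \<Rightarrow> ('a \<Rightarrow> 'a \<Rightarrow> 'f) \<Rightarrow> bool" where
  "nondegenerate_bilinear_form smul form \<longleftrightarrow>
     (\<forall>a. Vector_Spaces.linear smul (*) (\<lambda>b. form a b)) \<and>
     (\<forall>b. Vector_Spaces.linear smul (*) (\<lambda>a. form a b)) \<and>
     (\<forall>a b. form a b = form b a) \<and>
     (\<forall>a. (\<forall>b. form a b = 0) \<longrightarrow> a = 0)"

definition permits_composition ::
  "('a \<Rightarrow> 'a \<Rightarrow> 'a) \<Rightarrow> ('a \<Rightarrow> 'a \<Rightarrow> 'f::field) \<Rightarrow> bool" where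
  "permits_composition mul form \<longleftrightarrow>
     (\<forall>a b. form (mul a b) (mul a b) = form a a * form b b)"

definition algebra_isomorphic ::
  "('f::field \<Rightarrow> 'a::ab_group_add \<Rightarrow> 'a) \<Rightarrow> ('a \<Rightarrow> 'a \<Rightarrow> 'a) \<Rightarrow>
   ('f \<Rightarrow> 'b::ab_group_add \<Rightarrow> 'b) \<Rightarrow> ('b \<Rightarrow> 'b \<Rightarrow> 'b) \<Rightarrow> bool" where
  "algebra_isomorphic smul1 mul1 smul2 mul2 \<longleftrightarrow>
     (\<exists>\<phi>. Vector_Spaces.linear smul1 smul2 \<phi> \<and> bij \<phi> \<and>
        (\<forall>a b. \<phi> (mul1 a b) = mul2 (\<phi> a) (\<phi> b)))"

(* An extension field K of F, seen as an F-algebra; F embeds as the multiples of 1. *)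
definition quadratic_field_extension ::
  "('f::field \<Rightarrow> 'a::ab_group_add \<Rightarrow> 'a) \<Rightarrow> ('a \<Rightarrow> 'a \<Rightarrow> 'a) \<Rightarrow> bool" where
  "quadratic_field_extension smul mul \<longleftrightarrow>
     nonassoc_algebra smul mul \<and> associative mul \<and> commutative mul \<and>
     (\<exists>e. two_sided_identity mul e \<and> e \<noteq> 0 \<and> (\<forall>a. a \<noteq> 0 \<longrightarrow> (\<exists>b. mul a b = e))) \<and>
     vector_space.dim smul (UNIV :: 'a set) = 2"

definition quaternion_basis ::
  "('f::field \<Rightarrow> 'a::ab_group_add \<Rightarrow> 'a) \<Rightarrow> ('a \<Rightarrow> 'a \<Rightarrow> 'a) \<Rightarrow> 'a \<Rightarrow> 'a \<Rightarrow> 'a \<Rightarrow> bool" where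
  "quaternion_basis smul mul e p q \<longleftrightarrow>
     two_sided_identity mul e \<and>
     distinct [e, p, q, mul p q] \<and>
     \<not> module.dependent smul {e, p, q, mul p q} \<and>
     module.span smul {e, p, q, mul p q} = UNIV \<and>
     (\<exists>\<alpha>. \<alpha> \<noteq> 0 \<and> mul p p = smul \<alpha> e) \<and>
     (\<exists>\<beta>. \<beta> \<noteq> 0 \<and> mul q q = smul \<beta> e) \<and>
     mul p q = - mul q p"

definition quaternion_algebra ::
  "('f::field \<Rightarrow> 'a::ab_group_add \<Rightarrow> 'a) \<Rightarrow> ('a \<Rightarrow> 'a \<Rightarrow> 'a) \<Rightarrow> bool" where
  "quaternion_algebra smul mul \<longleftrightarrow>
     nonassoc_algebra smul mul \<and> associative mul \<and>
     (\<exists>e p q. quaternion_basis smul mul e p q)"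

(* The conjugation determined by a basis 1, p, q, pq; it does not depend on the basis. *)
definition standard_involution ::
  "('f::field \<Rightarrow> 'a::ab_group_add \<Rightarrow> 'a) \<Rightarrow> ('a \<Rightarrow> 'a \<Rightarrow> 'a) \<Rightarrow> ('a \<Rightarrow> 'a) \<Rightarrow> bool" where
  "standard_involution smul mul star \<longleftrightarrow>
     Vector_Spaces.linear smul smul star \<and>
     (\<exists>e p q. quaternion_basis smul mul e p q \<and>
        star e = e \<and> star p = - p \<and> star q = - q \<and> star (mul p q) = - mul p q)"

definition doubling_smul ::
  "('f \<Rightarrow> 'a \<Rightarrow> 'a) \<Rightarrow> 'f \<Rightarrow> 'a \<times> 'a \<Rightarrow> 'a \<times> 'a" where
  "doubling_smul smul r = (\<lambda>(a, b). (smul r a, smul r b))"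

definition doubling_mul ::
  "('f \<Rightarrow> 'a::ab_group_add \<Rightarrow> 'a) \<Rightarrow> ('a \<Rightarrow> 'a \<Rightarrow> 'a) \<Rightarrow> ('a \<Rightarrow> 'a) \<Rightarrow> 'f \<Rightarrow>
   'a \<times> 'a \<Rightarrow> 'a \<times> 'a \<Rightarrow> 'a \<times> 'a" where
  "doubling_mul smul mul star \<gamma> = (\<lambda>(a, b) (c, d).
     (mul a c + smul \<gamma> (mul (star d) b), mul d a + mul b (star c)))"

definition octonion_algebra ::
  "('f::field \<Rightarrow> 'q::ab_group_add \<times> 'q \<Rightarrow> 'q \<times> 'q) \<Rightarrow>
   ('q \<times> 'q \<Rightarrow> 'q \<times> 'q \<Rightarrow> 'q \<times> 'q) \<Rightarrow> bool" where
  "octonion_algebra smul mul \<longleftrightarrow>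
     (\<exists>smulQ mulQ star \<gamma>.
        quaternion_algebra smulQ mulQ \<and> standard_involution smulQ mulQ star \<and> \<gamma> \<noteq> 0 \<and>
        smul = doubling_smul smulQ \<and> mul = doubling_mul smulQ mulQ star \<gamma>)"

(* HOL cannot quantify existentially over types, so the algebras in the list are taken
   on the additive groups F, F^2, F^4 and F^4 x F^4.  Up to isomorphism this loses
   nothing: every algebra of dimension n over F can be transported to F^n. *)
definition isomorphic_to_F_or_quadratic_or_quaternion_or_octonion ::
  "('f::field \<Rightarrow> 'a::ab_group_add \<Rightarrow> 'a) \<Rightarrow> ('a \<Rightarrow> 'a \<Rightarrow> 'a) \<Rightarrow> bool" where
  "isomorphic_to_F_or_quadratic_or_quaternion_or_octonion smul mul \<longleftrightarrow>
     algebra_isomorphic smul mul ((*) :: 'f \<Rightarrow> 'f \<Rightarrow> 'f) (*) \<or>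
     (\<exists>(smulK :: 'f \<Rightarrow> 'f \<times> 'f \<Rightarrow> 'f \<times> 'f) mulK.
        quadratic_field_extension smulK mulK \<and>
        algebra_isomorphic smul mul smulK mulK) \<or>
     (\<exists>(smulQ :: 'f \<Rightarrow> 'f \<times> 'f \<times> 'f \<times> 'f \<Rightarrow> 'f \<times> 'f \<times> 'f \<times> 'f) mulQ.
        quaternion_algebra smulQ mulQ \<and>
        algebra_isomorphic smul mul smulQ mulQ) \<or>
     (\<exists>(smulO :: 'f \<Rightarrow> ('f \<times> 'f \<times> 'f \<times> 'f) \<times> ('f \<times> 'f \<times> 'f \<times> 'f) \<Rightarrow>
                    ('f \<times> 'f \<times> 'f \<times> 'f) \<times> ('f \<times> 'f \<times> 'f \<times> 'f)) mulO.
        octonion_algebra smulO mulO \<and>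
        algebra_isomorphic smul mul smulO mulO)"

end

theory Submission
  imports Defs
begin

text \<open>
  Both parts reduce to a unital algebra with an anisotropic symmetric bilinear form that permits
  composition.  In part (ii) flexibility makes the one-sided identity two-sided, and
  $\bar a (a b) = \langle a, a\rangle b$ turns an isotropic vector into a zero-divisor.  In part (i)
  the elements with scalar square that are not scalars form, together with 0, a complement of the
  scalars; let $T$ be the projection onto the scalars.  Left alternativity forces $T(ab) = T(ba)$,
  and $\langle a, b\rangle = 2\,T(a)\,T(b) - T(ab)$ permits composition; the right alternative
  case is the opposite algebra.

  In such an algebra, a subalgebra $B$ containing the identity and admitting orthogonal projections
  generates with any $w \neq 0$ orthogonal to it the Cayley--Dickson double $B + Bw$, which again
  admits orthogonal projections.  Moreover $B$ is associative whenever such a $w$ exists.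
  Starting from the scalars this produces dimensions 1, 2, 4, 8 and stops there, because the
  octonions are not associative.
\<close>

section \<open>Composition algebras\<close>

context nonassoc_algebra
begin

notation mul (infixl \<open>\<cdot>\<close> 70)
notation smul (infixr \<open>\<odot>\<close> 75)

lemma mul_zero_left [simp]: "0 \<cdot> a = 0"
  using mul_add_left [of 0 0 a] by simp

lemma mul_zero_right [simp]: "a \<cdot> 0 = 0"
  using mul_add_right [of a 0 0] by simp

lemma mul_minus_left [simp]: "- a \<cdot> b = - (a \<cdot> b)"
  using mul_add_left [of a "- a" b] by (simp add: eq_neg_iff_add_eq_0 add.commute)

lemma mul_minus_right [simp]: "a \<cdot> - b = - (a \<cdot> b)"
  using mul_add_right [of a b "- b"] by (simp add: eq_neg_iff_add_eq_0 add.commute)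

lemma mul_diff_left: "(a - b) \<cdot> c = a \<cdot> c - b \<cdot> c"
  using mul_add_left [of a "- b" c] by simp

lemma mul_diff_right: "a \<cdot> (b - c) = a \<cdot> b - a \<cdot> c"
  using mul_add_right [of a b "- c"] by simp

lemmas mul_linear = mul_add_left mul_add_right mul_diff_left mul_diff_right
  mul_smul_left mul_smul_right

lemma smul_double: "(2 * r) \<odot> a = r \<odot> a + r \<odot> a"
  by (simp only: mult_2 scale_left_distrib)

end

section \<open>Polarisation and conjugation in unital composition algebras\<close>

locale unital_composition_algebra = nonassoc_algebra smul mul
  for smul :: "'f::field \<Rightarrow> 'a::ab_group_add \<Rightarrow> 'a" and mul +
  fixes e :: 'a and N :: "'a \<Rightarrow> 'a \<Rightarrow> 'f"
  assumes two_neq_0: "(2::'f) \<noteq> 0"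
    and unit_left [simp]: "e \<cdot> a = a"
    and unit_right [simp]: "a \<cdot> e = a"
    and N_sym: "N a b = N b a"
    and N_add_left: "N (a + b) c = N a c + N b c"
    and N_smul_left: "N (r \<odot> a) b = r * N a b"
    and N_nondegenerate: "(\<And>b. N a b = 0) \<Longrightarrow> a = 0"
    and N_mul: "N (a \<cdot> b) (a \<cdot> b) = N a a * N b b"
begin

lemma N_add_right: "N a (b + c) = N a b + N a c"
  by (metis N_add_left N_sym)

lemma N_smul_right: "N a (r \<odot> b) = r * N a b"
  by (metis N_smul_left N_sym)

lemma N_zero_left [simp]: "N 0 a = 0"
  using N_smul_left [of 0 0 a] by simp

lemma N_minus_left [simp]: "N (- a) b = - N a b"
  using N_add_left [of a "- a" b] by (simp add: eq_neg_iff_add_eq_0 add.commute)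

lemma N_diff_left: "N (a - b) c = N a c - N b c"
  using N_add_left [of a "- b" c] by simp

lemma N_diff_right: "N a (b - c) = N a b - N a c"
  by (metis N_diff_left N_sym)

lemmas N_linear = N_add_left N_add_right N_diff_left N_diff_right N_smul_left N_smul_right

lemma N_zero_right [simp]: "N a 0 = 0"
  by (metis N_sym N_zero_left)

lemma N_ext: "(\<And>z. N z x = N z y) \<Longrightarrow> x = y"
  using N_nondegenerate [of "x - y"] by (simp add: N_sym [of "x - y"] N_diff_right)

lemma e_neq_0: "e \<noteq> 0"
proof
  assume "e = 0"
  then have "a = 0" for a :: 'a
    using unit_left [of a] by simp
  then show False
    using nonzero_algebra by blast
qed

lemma two_mult_cancel: "(2::'f) * x = 2 * y \<Longrightarrow> x = y"
  using two_neq_0 by simp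

lemma N_add_same: "N (a + b) (a + b) = N a a + 2 * N a b + N b b"
  by (simp add: N_linear N_sym [of b a])

text \<open>If all \<open>N b b\<close> vanished, polarisation and 2 \<noteq> 0 would make
  \<open>e\<close> orthogonal to everything. So some \<open>N b b\<close> is nonzero and can be
  cancelled from the composition law for \<open>e \<cdot> b\<close>.\<close>

lemma N_e [simp]: "N e e = 1"
proof -
  have "\<exists>b. N b b \<noteq> 0"
  proof (rule ccontr)
    assume zero: "\<nexists>b. N b b \<noteq> 0"
    have "N e b = 0" for b
      using N_add_same [of e b] zero two_neq_0 by simp
    then show False
      using N_nondegenerate e_neq_0 by blast
  qed
  then obtain b where "N b b \<noteq> 0"
    by blast
  then show ?thesis
    using N_mul [of e b] by simp
qed

lemma N_mul_same_left: "N (a \<cdot> b) (a \<cdot> c) = N a a * N b c"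
proof (rule two_mult_cancel)
  show "2 * N (a \<cdot> b) (a \<cdot> c) = 2 * (N a a * N b c)"
    using N_mul [of a "b + c"] by (simp add: mul_add_right N_add_same N_mul distrib_left)
qed

text \<open>Second polarisation, in the left factor; \<open>N_mul_same_left\<close> is the first, in
  the right factor.\<close>

lemma N_mul_polarized:
  "N (a \<cdot> b) (c \<cdot> d) + N (a \<cdot> d) (c \<cdot> b) = 2 * N a c * N b d"
  using N_mul_same_left [of "a + c" b d]
  by (simp add: mul_add_left N_add_left N_add_right N_add_same N_mul_same_left
      N_sym [of "c \<cdot> b" "a \<cdot> d"] N_sym [of c a] distrib_right add_ac)

text \<open>Conjugation: it fixes \<open>e\<close> and is -1 on the orthogonal complement of
  \<open>e\<close>.\<close>

definition bar :: "'a \<Rightarrow> 'a" where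
  "bar a = (2 * N a e) \<odot> e - a"

lemma bar_bar [simp]: "bar (bar a) = a"
  by (simp add: bar_def N_linear algebra_simps)

lemma bar_add: "bar (a + b) = bar a + bar b"
  by (simp add: bar_def N_linear algebra_simps)

lemma bar_orthogonal: "N a e = 0 \<Longrightarrow> bar a = - a"
  by (simp add: bar_def)

text \<open>The polarised composition law with one left factor equal to \<open>e\<close>. Together
  with nondegeneracy, the two adjoint rules replace associativity in all that follows.\<close>

lemma N_adjoint_left: "N (a \<cdot> b) c = N b (bar a \<cdot> c)"
  using N_mul_polarized [of a b e c] N_sym [of "a \<cdot> c" b]
  by (simp add: bar_def mul_linear N_linear algebra_simps)

lemma N_adjoint_right: "N (a \<cdot> b) c = N a (c \<cdot> bar b)"
  using N_mul_polarized [of a b c e]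
  by (simp add: bar_def mul_linear N_linear algebra_simps)

lemma bar_mul_cancel: "bar a \<cdot> (a \<cdot> b) = N a a \<odot> b"
  by (rule N_ext) (simp add: N_adjoint_left [symmetric] N_mul_same_left N_linear)

lemma N_mul_same_right: "N (b \<cdot> a) (c \<cdot> a) = N a a * N b c"
  by (rule two_mult_cancel) (use N_mul_polarized [of b a c a] in \<open>simp add: algebra_simps\<close>)

lemma mul_bar_cancel: "(b \<cdot> a) \<cdot> bar a = N a a \<odot> b"
  by (rule N_ext) (simp add: N_adjoint_right [symmetric] N_mul_same_right N_linear)

lemma bar_mul_polarized: "bar a \<cdot> (b \<cdot> c) + bar b \<cdot> (a \<cdot> c) = (2 * N a b) \<odot> c"
  using bar_mul_cancel [of "a + b" c]
  by (simp add: bar_add mul_add_left mul_add_right scale_left_distrib N_add_same bar_mul_cancel add_ac)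

lemma mul_bar_polarized: "(c \<cdot> a) \<cdot> bar b + (c \<cdot> b) \<cdot> bar a = (2 * N a b) \<odot> c"
  using mul_bar_cancel [of c "a + b"]
  by (simp add: bar_add mul_add_left mul_add_right scale_left_distrib N_add_same mul_bar_cancel add_ac)

text \<open>Both sides are paired with an arbitrary \<open>z\<close>; only adjoints are moved, so no
  associativity is required.\<close>

lemma bar_mul: "bar (a \<cdot> b) = bar b \<cdot> bar a"
proof (rule N_ext)
  fix z
  have *: "N z (bar x) = N (z \<cdot> x) e" for z x :: 'a
    using N_adjoint_right [of z x e] by simp
  have "N z (bar (a \<cdot> b)) = N (a \<cdot> b) (bar z)"
    using * [of z "a \<cdot> b"] N_adjoint_left [of z "a \<cdot> b" e] by simp
  also have "\<dots> = N b (bar a \<cdot> bar z)"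
    by (rule N_adjoint_left)
  also have "\<dots> = N (b \<cdot> z) (bar a)"
    by (rule N_adjoint_right [symmetric])
  also have "\<dots> = N z (bar b \<cdot> bar a)"
    by (rule N_adjoint_left)
  finally show "N z (bar (a \<cdot> b)) = N z (bar b \<cdot> bar a)" .
qed

text \<open>In \<open>bar_mul_polarized\<close> for \<open>bar a\<close> and \<open>x\<close> the
  right-hand side vanishes and \<open>bar x = - x\<close>. This lets a vector orthogonal to a
  subalgebra move past its elements at the cost of a conjugation.\<close>

lemma orthogonal_swap:
  assumes "N x e = 0" and "N x (bar a) = 0"
  shows "a \<cdot> (x \<cdot> z) = x \<cdot> (bar a \<cdot> z)"
  using bar_mul_polarized [of "bar a" x z] assms
  by (simp add: bar_orthogonal N_sym [of "bar a"])

end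

locale anisotropic_composition_algebra = unital_composition_algebra smul mul e N
  for smul :: "'f::field \<Rightarrow> 'a::ab_group_add \<Rightarrow> 'a" and mul e N +
  assumes N_anisotropic: "N a a = 0 \<Longrightarrow> a = 0"

section \<open>Cayley--Dickson doubling of a subalgebra\<close>

lemma doubling_smul_Pair [simp]: "doubling_smul sm r (a, b) = (sm r a, sm r b)"
  by (simp add: doubling_smul_def)

lemma doubling_mul_Pair [simp]:
  "doubling_mul sm m star \<gamma> (a, b) (c, d) =
     (m a c + sm \<gamma> (m (star d) b), m d a + m b (star c))"
  by (simp add: doubling_mul_def)

context anisotropic_composition_algebra
begin

text \<open>
  The last clause says that the image admits orthogonal projections; it replaces
  finite-dimensionality, which is not assumed of the ambient algebra.
\<close>

definition embedding ::
  "('f \<Rightarrow> 'b::ab_group_add \<Rightarrow> 'b) \<Rightarrow> ('b \<Rightarrow> 'b \<Rightarrow> 'b) \<Rightarrow> ('b \<Rightarrow> 'b) \<Rightarrow> ('b \<Rightarrow> 'a) \<Rightarrow> bool" where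
  "embedding sm m star \<psi> \<longleftrightarrow>
     inj \<psi> \<and> e \<in> range \<psi> \<and>
     (\<forall>x y. \<psi> (x + y) = \<psi> x + \<psi> y) \<and>
     (\<forall>r x. \<psi> (sm r x) = r \<odot> \<psi> x) \<and>
     (\<forall>x y. \<psi> (m x y) = \<psi> x \<cdot> \<psi> y) \<and>
     (\<forall>x. \<psi> (star x) = bar (\<psi> x)) \<and>
     (\<forall>x. \<exists>b. \<forall>c. N (x - \<psi> b) (\<psi> c) = 0)"

lemma embeddingD:
  assumes "embedding sm m star \<psi>"
  shows "inj \<psi>" "e \<in> range \<psi>" "\<psi> (x + y) = \<psi> x + \<psi> y" "\<psi> (sm r x) = r \<odot> \<psi> x"
    "\<psi> (m x y) = \<psi> x \<cdot> \<psi> y" "\<psi> (star x) = bar (\<psi> x)"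
    "\<exists>b. \<forall>c. N (z - \<psi> b) (\<psi> c) = 0"
  using assms unfolding embedding_def by blast+

lemma embedding_minus:
  assumes "embedding sm m star \<psi>"
  shows "\<psi> (- x) = - \<psi> x"
  using embeddingD(3) [OF assms, of x "- x"] embeddingD(3) [OF assms, of 0 0]
  by (simp add: eq_neg_iff_add_eq_0 add.commute)

lemma embedding_diff:
  assumes "embedding sm m star \<psi>"
  shows "\<psi> (x - y) = \<psi> x - \<psi> y"
  using embeddingD(3) [OF assms, of x "- y"] embedding_minus [OF assms] by simp

text \<open>A vector outside the range differs from its orthogonal projection, and the difference
  serves as \<open>w\<close>.\<close>

lemma exists_orthogonal:
  assumes "embedding sm m star \<psi>" and "\<not> surj \<psi>"
  obtains w where "w \<noteq> 0" "\<And>c. N w (\<psi> c) = 0"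
proof -
  from assms(2) obtain x where x: "x \<notin> range \<psi>"
    by auto
  obtain b where b: "\<forall>c. N (x - \<psi> b) (\<psi> c) = 0"
    using embeddingD(7) [OF assms(1)] by blast
  have "x - \<psi> b \<noteq> 0"
    using x by auto
  then show ?thesis
    using b that by blast
qed

context
  fixes sm :: "'f \<Rightarrow> 'b::ab_group_add \<Rightarrow> 'b" and m star \<psi> w
  assumes emb: "embedding sm m star \<psi>"
    and w_neq_0: "w \<noteq> 0" and w_orthogonal: "\<And>c. N w (\<psi> c) = 0"
begin

lemma N_w: "N w w \<noteq> 0"
  using N_anisotropic w_neq_0 by blast

lemma w_orthogonal_e: "N w e = 0"
  using embeddingD(2) [OF emb] w_orthogonal by auto

lemma bar_w: "bar w = - w"
  using w_orthogonal_e by (rule bar_orthogonal)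

text \<open>Taking the adjoint leaves \<open>w\<close> against
  \<open>bar (\<psi> b) \<cdot> \<psi> c\<close>, which is again in the range of
  \<open>\<psi>\<close>.\<close>

lemma mul_w_orthogonal: "N (\<psi> b \<cdot> w) (\<psi> c) = 0"
  using w_orthogonal [of "m (star b) c"]
  by (simp add: N_adjoint_left embeddingD(5,6) [OF emb])

lemma mul_w_orthogonal_e: "N (\<psi> b \<cdot> w) e = 0"
  using embeddingD(2) [OF emb] mul_w_orthogonal by auto

lemma mul_w_eq_0_iff: "x \<cdot> w = 0 \<longleftrightarrow> x = 0"
  using mul_bar_cancel [of x w] N_w by auto

lemma w_swap: "\<psi> a \<cdot> (w \<cdot> z) = w \<cdot> (bar (\<psi> a) \<cdot> z)"
  using orthogonal_swap [of w "\<psi> a" z] w_orthogonal_e w_orthogonal [of "star a"]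
  by (simp add: embeddingD(6) [OF emb])

lemma mul_w_swap: "\<psi> a \<cdot> ((\<psi> b \<cdot> w) \<cdot> z) = (\<psi> b \<cdot> w) \<cdot> (bar (\<psi> a) \<cdot> z)"
  using orthogonal_swap [of "\<psi> b \<cdot> w" "\<psi> a" z] mul_w_orthogonal_e mul_w_orthogonal [of b "star a"]
  by (simp add: embeddingD(6) [OF emb])

lemma w_commute: "\<psi> a \<cdot> w = w \<cdot> bar (\<psi> a)"
  using w_swap [of a e] by simp

text \<open>Carrying \<open>w\<close> to the far left conjugates both factors; carrying it back
  conjugates their product, which reverses the order.\<close>

lemma mul_mul_w: "\<psi> a \<cdot> (\<psi> d \<cdot> w) = (\<psi> d \<cdot> \<psi> a) \<cdot> w"
proof -
  have "\<psi> a \<cdot> (\<psi> d \<cdot> w) = w \<cdot> (bar (\<psi> a) \<cdot> bar (\<psi> d))"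
    by (simp add: w_commute w_swap)
  also have "\<dots> = (\<psi> d \<cdot> \<psi> a) \<cdot> w"
    using w_commute [of "m d a"] by (simp add: embeddingD(5) [OF emb] bar_mul)
  finally show ?thesis .
qed

lemma mul_w_mul: "(\<psi> b \<cdot> w) \<cdot> \<psi> c = (\<psi> b \<cdot> bar (\<psi> c)) \<cdot> w"
  using mul_bar_polarized [of "\<psi> b" w "bar (\<psi> c)"] w_orthogonal [of "star c"]
  by (simp add: bar_w embeddingD(6) [OF emb])

text \<open>Swapping \<open>bar (\<psi> d)\<close> past \<open>\<psi> b \<cdot> w\<close> brings the
  two copies of \<open>w\<close> together, where \<open>mul_bar_cancel\<close> applies.\<close>

lemma mul_w_mul_w: "(\<psi> b \<cdot> w) \<cdot> (\<psi> d \<cdot> w) = (- N w w) \<odot> (bar (\<psi> d) \<cdot> \<psi> b)"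
proof -
  have "(\<psi> b \<cdot> w) \<cdot> w = (- N w w) \<odot> \<psi> b"
    using arg_cong [OF mul_bar_cancel [of "\<psi> b" w], of uminus] by (simp add: bar_w)
  moreover have "bar (\<psi> d) \<cdot> ((\<psi> b \<cdot> w) \<cdot> w) = (\<psi> b \<cdot> w) \<cdot> (\<psi> d \<cdot> w)"
    using mul_w_swap [of "star d" b w] by (simp add: embeddingD(6) [OF emb])
  ultimately show ?thesis
    by (simp add: mul_linear)
qed

text \<open>\<open>mul_mul_w\<close>, \<open>mul_w_mul\<close> and \<open>mul_w_mul_w\<close> are
  the mixed terms of the doubling product with \<gamma> = \<open>- N w w\<close>.\<close>

lemma embedding_doubling:
  "embedding (doubling_smul sm) (doubling_mul sm m star (- N w w))
     (\<lambda>(x, y). (star x, - y)) (\<lambda>(x, y). \<psi> x + \<psi> y \<cdot> w)"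
    (is "embedding _ _ _ ?\<psi>")
  unfolding embedding_def
proof (intro conjI allI)
  note [simp] = embeddingD(3-6) [OF emb] embedding_minus [OF emb] embedding_diff [OF emb]
  have \<psi>_0: "\<psi> 0 = 0"
    using embeddingD(3) [OF emb, of 0 0] by simp
  have "x = x' \<and> y = y'" if eq: "\<psi> x + \<psi> y \<cdot> w = \<psi> x' + \<psi> y' \<cdot> w" for x y x' y'
  proof -
    \<comment> \<open>The difference lies both in the subalgebra and in its translate by
      \<open>w\<close>. These are orthogonal, so it is orthogonal to itself and vanishes by
      anisotropy.\<close>
    define p q where "p = x - x'" and "q = y' - y"
    have pq: "\<psi> p = \<psi> q \<cdot> w"
      using eq by (simp add: p_def q_def mul_linear algebra_simps)
    then have "N (\<psi> p) (\<psi> p) = 0"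
      using mul_w_orthogonal [of q p] by simp
    then have "\<psi> p = 0"
      by (rule N_anisotropic)
    moreover from this have "\<psi> q = 0"
      using pq mul_w_eq_0_iff by simp
    ultimately have "p = 0" "q = 0"
      using \<psi>_0 embeddingD(1) [OF emb] by (metis injD)+
    then show ?thesis
      by (simp add: p_def q_def)
  qed
  then show "inj ?\<psi>"
    by (auto simp: inj_def)
  obtain x where "e = \<psi> x"
    using embeddingD(2) [OF emb] by blast
  then have "e = ?\<psi> (x, 0)"
    using \<psi>_0 by simp
  then show "e \<in> range ?\<psi>"
    by blast
  fix x y :: "'b \<times> 'b" and r
  obtain x1 x2 y1 y2 where xy: "x = (x1, x2)" "y = (y1, y2)"
    by fastforce
  show "?\<psi> (x + y) = ?\<psi> x + ?\<psi> y"
    by (simp add: xy mul_linear algebra_simps)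
  show "?\<psi> (doubling_smul sm r x) = r \<odot> ?\<psi> x"
    by (simp add: xy mul_linear algebra_simps)
  show "?\<psi> (doubling_mul sm m star (- N w w) x y) = ?\<psi> x \<cdot> ?\<psi> y"
    by (simp add: xy mul_add_left mul_add_right mul_mul_w mul_w_mul mul_w_mul_w add_ac)
  have "bar (\<psi> x2 \<cdot> w) = - (\<psi> x2 \<cdot> w)"
    using mul_w_orthogonal_e by (rule bar_orthogonal)
  then show "?\<psi> (case x of (x, y) \<Rightarrow> (star x, - y)) = bar (?\<psi> x)"
    by (simp add: xy bar_add)
next
  fix x
  note [simp] = embeddingD(3-6) [OF emb] embedding_minus [OF emb]
  obtain b where b: "\<And>c. N (x - \<psi> b) (\<psi> c) = 0"
    using embeddingD(7) [OF emb] by blast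
  obtain d where d: "\<And>c. N (x \<cdot> bar w - \<psi> d) (\<psi> c) = 0"
    using embeddingD(7) [OF emb] by blast
  \<comment> \<open>The coefficient of the projection onto the translate: multiplication by
    \<open>bar w\<close> is adjoint to multiplication by \<open>w\<close>, and the latter scales the
    form by \<open>N w w\<close>.\<close>
  define d' where "d' = sm (inverse (N w w)) d"
  have "N (x - (\<psi> b + \<psi> d' \<cdot> w)) (\<psi> c) = 0" for c
    using b [of c] mul_w_orthogonal [of d' c] by (simp add: N_linear)
  moreover have "N (x - (\<psi> b + \<psi> d' \<cdot> w)) (\<psi> c \<cdot> w) = 0" for c
  proof -
    have "N x (\<psi> c \<cdot> w) = N (\<psi> d) (\<psi> c)"
      using d [of c] N_adjoint_right [of "\<psi> c" w x]
      by (simp add: N_linear N_sym [of "\<psi> c \<cdot> w"] N_sym [of "\<psi> c"])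
    moreover have "N (\<psi> b) (\<psi> c \<cdot> w) = 0"
      using mul_w_orthogonal [of c b] by (simp add: N_sym)
    moreover have "N (\<psi> d' \<cdot> w) (\<psi> c \<cdot> w) = N (\<psi> d) (\<psi> c)"
      using N_w by (simp add: N_mul_same_right d'_def N_linear)
    ultimately show ?thesis
      by (simp add: N_linear)
  qed
  ultimately have "\<forall>c. N (x - ?\<psi> (b, d')) (?\<psi> c) = 0"
    by (auto simp: N_add_right)
  then show "\<exists>b. \<forall>c. N (x - ?\<psi> b) (?\<psi> c) = 0"
    by blast
qed

text \<open>
  Evaluate \<open>\<psi> a \<cdot> ((\<psi> c \<cdot> w) \<cdot> (\<psi> d \<cdot> w))\<close> with and without moving \<open>\<psi> a\<close> past \<open>\<psi> c \<cdot> w\<close>.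
\<close>

lemma embedding_proper_imp_assoc: "m a (m b c) = m (m a b) c"
proof (rule injD [OF embeddingD(1) [OF emb]])
  note hom = embeddingD(5,6) [OF emb]
  define d where "d = star b"
  have b: "\<psi> b = bar (\<psi> d)"
    by (simp add: d_def hom)
  have "(- N w w) \<odot> (\<psi> a \<cdot> (bar (\<psi> d) \<cdot> \<psi> c)) = \<psi> a \<cdot> ((\<psi> c \<cdot> w) \<cdot> (\<psi> d \<cdot> w))"
    by (simp only: mul_w_mul_w mul_smul_right)
  also have "\<dots> = (\<psi> c \<cdot> w) \<cdot> (\<psi> (m d (star a)) \<cdot> w)"
    using mul_mul_w [of "star a" d] by (simp add: mul_w_swap hom)
  also have "\<dots> = (- N w w) \<odot> ((\<psi> a \<cdot> bar (\<psi> d)) \<cdot> \<psi> c)"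
    unfolding mul_w_mul_w by (simp add: hom bar_mul)
  finally show "\<psi> (m a (m b c)) = \<psi> (m (m a b) c)"
    using N_w by (simp add: b hom(1))
qed

end

end

section \<open>The norm form of a left alternative quadratic algebra\<close>

text \<open>\<open>square_scalar\<close> is the form in which absence of zero-divisors enters: if
  a^2 = r^2 e, then (a - re)(a + re) = 0.\<close>

locale anisotropic_quadratic_left_alternative = nonassoc_algebra smul mul
  for smul :: "'f::field \<Rightarrow> 'a::ab_group_add \<Rightarrow> 'a" and mul +
  fixes e :: 'a
  assumes two_neq_0: "(2::'f) \<noteq> 0"
    and unit_left [simp]: "e \<cdot> a = a"
    and unit_right [simp]: "a \<cdot> e = a"
    and left_alt: "a \<cdot> (a \<cdot> b) = (a \<cdot> a) \<cdot> b"
    and quadratic: "\<exists>s t. a \<cdot> a = s \<odot> a + t \<odot> e"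
    and square_scalar: "a \<cdot> a = (r * r) \<odot> e \<Longrightarrow> \<exists>c. a = c \<odot> e"
begin

lemma e_neq_0 [simp]: "e \<noteq> 0"
proof
  assume "e = 0"
  then have "a = 0" for a :: 'a
    using unit_left [of a] by simp
  then show False
    using nonzero_algebra by blast
qed

text \<open>The imaginary elements. The second conjunct admits 0 but no other scalar, so that these
  elements form a subspace.\<close>

definition pure :: "'a \<Rightarrow> bool" where
  "pure v \<longleftrightarrow> (\<exists>\<alpha>. v \<cdot> v = \<alpha> \<odot> e) \<and> (\<forall>c. v = c \<odot> e \<longrightarrow> v = 0)"

lemma pure_0 [simp]: "pure 0"
  by (auto simp: pure_def intro: exI [of _ 0])

lemma pure_smul:
  assumes "pure v"
  shows "pure (r \<odot> v)"
proof (cases "r = 0")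
  case False
  obtain \<alpha> where \<alpha>: "v \<cdot> v = \<alpha> \<odot> e" and v: "\<And>c. v = c \<odot> e \<Longrightarrow> v = 0"
    using assms by (auto simp: pure_def)
  have "r \<odot> v \<cdot> r \<odot> v = (r * r * \<alpha>) \<odot> e"
    by (simp add: mul_linear \<alpha> mult.assoc)
  moreover have "v = 0" if "r \<odot> v = c \<odot> e" for c
  proof (rule v)
    show "v = (inverse r * c) \<odot> e"
      using arg_cong [OF that, of "smul (inverse r)"] False by simp
  qed
  ultimately show ?thesis
    by (auto simp: pure_def)
qed simp

text \<open>If \<open>v\<close> is a combination of \<open>u\<close> and \<open>e\<close>, its
  square is scalar only if \<open>u = 0\<close> or one coefficient vanishes. Otherwise the sum of
  the squares of \<open>u + v\<close> and \<open>u - v\<close> is scalar, and comparing coefficients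
  in their quadratic equations leaves no linear term unless \<open>u = 0\<close>.\<close>

lemma pure_add:
  assumes u: "pure u" and v: "pure v"
  shows "pure (u + v)"
proof -
  obtain \<alpha> where \<alpha>: "u \<cdot> u = \<alpha> \<odot> e" and u0: "\<And>c. u = c \<odot> e \<Longrightarrow> u = 0"
    using u by (auto simp: pure_def)
  obtain \<beta> where \<beta>: "v \<cdot> v = \<beta> \<odot> e" and v0: "\<And>c. v = c \<odot> e \<Longrightarrow> v = 0"
    using v by (auto simp: pure_def)
  show ?thesis
  proof (cases "\<exists>c d. v = c \<odot> u + d \<odot> e")
    case True
    then obtain c d where vcd: "v = c \<odot> u + d \<odot> e"
      by blast
    have "v \<cdot> v = (c * c * \<alpha> + d * d) \<odot> e + (2 * c * d) \<odot> u"
      unfolding vcd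
      by (simp add: mul_linear \<alpha> scale_left_distrib scale_right_distrib mult.assoc smul_double mult.commute [of d c] add_ac)
    then have *: "(2 * c * d) \<odot> u = (\<beta> - c * c * \<alpha> - d * d) \<odot> e"
      using \<beta> by (simp add: algebra_simps)
    have "u = 0 \<or> 2 * c * d = 0"
    proof (cases "2 * c * d = 0")
      case False
      have "u = (inverse (2 * c * d) * (\<beta> - c * c * \<alpha> - d * d)) \<odot> e"
        using arg_cong [OF *, of "smul (inverse (2 * c * d))"] False by (simp del: inverse_mult_distrib)
      then show ?thesis
        using u0 by blast
    qed simp
    then consider "u = 0" | "c = 0" | "d = 0"
      using two_neq_0 by auto
    then show ?thesis
    proof cases
      case 2
      then show ?thesis
        using v0 [of d] vcd u by simp
    next
      case 3
      then have "u + v = (1 + c) \<odot> u"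
        using vcd by (simp add: scale_left_distrib)
      then show ?thesis
        using pure_smul u by simp
    qed (simp add: v)
  next
    case False
    obtain s t where st: "(u + v) \<cdot> (u + v) = s \<odot> (u + v) + t \<odot> e"
      using quadratic by blast
    obtain s' t' where st': "(u - v) \<cdot> (u - v) = s' \<odot> (u - v) + t' \<odot> e"
      using quadratic by blast
    define k where "k = t + t' - 2 * \<alpha> - 2 * \<beta>"
    have "(u + v) \<cdot> (u + v) + (u - v) \<cdot> (u - v) = (2 * \<alpha> + 2 * \<beta>) \<odot> e"
      by (simp add: mul_linear \<alpha> \<beta> scale_left_distrib smul_double)
    then have *: "(s' - s) \<odot> v = (s + s') \<odot> u + k \<odot> e"
      unfolding st st' k_def
      by (simp add: scale_left_distrib scale_right_distrib scale_left_diff_distrib scale_right_diff_distrib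
          smul_double algebra_simps)
    have s': "s' = s"
    proof (rule ccontr)
      assume "s' \<noteq> s"
      then have "v = (inverse (s' - s) * (s + s')) \<odot> u
          + (inverse (s' - s) * k) \<odot> e"
        using arg_cong [OF *, of "smul (inverse (s' - s))"] by (simp add: scale_right_distrib)
      then show False
        using False by blast
    qed
    have "s = 0 \<or> u = 0"
    proof (cases "s = 0")
      case s: False
      have "(2 * s) \<odot> u = (- k) \<odot> e"
        using * by (simp add: s' eq_neg_iff_add_eq_0 flip: mult_2)
      from arg_cong [OF this, of "smul (inverse (2 * s))"]
      have "u = (inverse (2 * s) * - k) \<odot> e"
        using s two_neq_0 by (simp del: inverse_mult_distrib)
      then show ?thesis
        using u0 by blast
    qed simp
    then show ?thesis
    proof
      assume "s = 0"
      then have "(u + v) \<cdot> (u + v) = t \<odot> e"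
        using st by simp
      moreover have "u + v \<noteq> c \<odot> e" for c
      proof
        assume "u + v = c \<odot> e"
        then have "v = (- 1) \<odot> u + c \<odot> e"
          by (simp add: algebra_simps)
        then show False
          using False by blast
      qed
      ultimately show ?thesis
        by (auto simp: pure_def)
    qed (simp add: v)
  qed
qed

lemma pure_decomposition: "\<exists>r. pure (a - r \<odot> e)"
proof (cases "\<exists>c. a = c \<odot> e")
  case True
  then obtain c where "a - c \<odot> e = 0"
    by auto
  then show ?thesis
    using pure_0 by metis
next
  case False
  obtain s t where st: "a \<cdot> a = s \<odot> a + t \<odot> e"
    using quadratic by blast
  \<comment> \<open>Completing the square.\<close>
  define r where "r = s / 2"
  have s: "s = r + r"
    using two_neq_0 by (simp add: r_def flip: mult_2)
  have "(a - r \<odot> e) \<cdot> (a - r \<odot> e) = (t + r * r) \<odot> e"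
    by (simp add: mul_linear st s scale_left_distrib scale_right_diff_distrib smul_double)
  moreover have "a - r \<odot> e \<noteq> c \<odot> e" for c
  proof
    assume "a - r \<odot> e = c \<odot> e"
    then have "a = (c + r) \<odot> e"
      by (simp add: algebra_simps)
    then show False
      using False by blast
  qed
  ultimately show ?thesis
    by (auto simp: pure_def)
qed

lemma pure_scalar_iff [simp]: "pure (c \<odot> e) \<longleftrightarrow> c = 0"
  by (auto simp: pure_def intro: exI [of _ 0])

text \<open>Half of the trace.\<close>

definition T :: "'a \<Rightarrow> 'f" where
  "T a = (THE r. pure (a - r \<odot> e))"

lemma T_eq_iff: "T a = r \<longleftrightarrow> pure (a - r \<odot> e)"
proof -
  have unique: "r = r'" if "pure (a - r \<odot> e)" "pure (a - r' \<odot> e)" for r r'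
  proof -
    have "pure ((a - r \<odot> e) + (- 1) \<odot> (a - r' \<odot> e))"
      using that pure_add pure_smul by blast
    also have "(a - r \<odot> e) + (- 1) \<odot> (a - r' \<odot> e) = (r' - r) \<odot> e"
      by (simp add: algebra_simps)
    finally show ?thesis
      by simp
  qed
  obtain r' where "pure (a - r' \<odot> e)"
    using pure_decomposition by blast
  then have "\<exists>!r. pure (a - r \<odot> e)"
    using unique by blast
  then show ?thesis
    using theI' unique unfolding T_def by (metis (no_types, lifting))
qed

lemma T_0_iff: "T a = 0 \<longleftrightarrow> pure a"
  by (simp add: T_eq_iff)

lemma T_scalar [simp]: "T (r \<odot> e) = r"
  by (simp add: T_eq_iff)

lemma T_e [simp]: "T e = 1"
  by (simp add: T_eq_iff)

lemma pure_minus_T: "pure (a - T a \<odot> e)"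
  using T_eq_iff by blast

lemma T_add: "T (a + b) = T a + T b"
  using pure_add [OF pure_minus_T [of a] pure_minus_T [of b]]
  by (simp add: T_eq_iff algebra_simps)

lemma T_smul: "T (r \<odot> a) = r * T a"
  using pure_smul [OF pure_minus_T [of a], of r]
  by (simp add: T_eq_iff algebra_simps)

lemma T_zero [simp]: "T 0 = 0"
  by (simp add: T_0_iff)

lemma T_minus [simp]: "T (- a) = - T a"
  using T_smul [of "- 1" a] by simp

lemma T_diff: "T (a - b) = T a - T b"
  using T_add [of a "- b"] by simp

lemmas T_linear = T_add T_diff T_smul

lemma T_0_square: "T a = 0 \<Longrightarrow> a \<cdot> a = T (a \<cdot> a) \<odot> e"
  by (auto simp: T_0_iff pure_def)

lemma square_eq: "a \<cdot> a = (2 * T a) \<odot> a - (2 * T a * T a - T (a \<cdot> a)) \<odot> e"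
proof -
  have "T (a - T a \<odot> e) = 0"
    by (simp add: T_linear)
  from T_0_square [OF this] show ?thesis
    by (simp add: mul_linear T_linear algebra_simps smul_double)
qed

text \<open>Linearising \<open>T_0_square\<close> shows that the anticommutator is a scalar.\<close>

lemma T_0_swap:
  assumes "T a = 0" "T b = 0"
  shows "b \<cdot> a = T (a \<cdot> b + b \<cdot> a) \<odot> e - a \<cdot> b"
  using T_0_square [of "a + b"] T_0_square [of a] T_0_square [of b] assms
  by (simp add: mul_linear T_linear algebra_simps)

lemma left_alt_T_0: "T a = 0 \<Longrightarrow> a \<cdot> (a \<cdot> b) = T (a \<cdot> a) \<odot> b"
  using T_0_square [of a] by (metis left_alt mul_smul_left unit_left)

text \<open>With r = 0 this makes squares of nonzero trace-zero elements nonzero scalars; with r =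
  \<open>T a\<close> it yields anisotropy of the norm.\<close>

lemma T_square_0:
  assumes "T a = 0" and "T (a \<cdot> a) = r * r"
  shows "a = 0"
proof -
  obtain c where "a = c \<odot> e"
    using T_0_square [OF assms(1)] square_scalar [of a r] assms(2) by auto
  then show ?thesis
    using assms(1) by simp
qed

text \<open>
  With \<open>w = u \<cdot> v\<close>, both sides of \<open>w \<cdot> (w \<cdot> u) = T (w \<cdot> w) \<odot> u\<close> are combinations of
  \<open>e, u, v, w\<close>; the functionals \<open>T\<close>, \<open>T (u \<cdot> _)\<close> and \<open>T (v \<cdot> _)\<close> separate the coefficients.
\<close>

lemma T_sym_orthogonal:
  assumes u: "T u = 0" and v: "T v = 0" and uv: "T (u \<cdot> v) = 0" and "u \<noteq> 0"
  shows "T (v \<cdot> u) = 0"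
proof (cases "v = 0")
  case False
  define w where "w = u \<cdot> v"
  define c where "c = T (v \<cdot> u)"
  define \<alpha> where "\<alpha> = T (u \<cdot> u)"
  define \<beta> where "\<beta> = T (v \<cdot> v)"
  have \<alpha>0: "\<alpha> \<noteq> 0" and \<beta>0: "\<beta> \<noteq> 0"
    using T_square_0 [of u 0] T_square_0 [of v 0] u v False \<open>u \<noteq> 0\<close> by (auto simp: \<alpha>_def \<beta>_def)
  have w: "T w = 0"
    using uv by (simp add: w_def)
  have vu: "v \<cdot> u = c \<odot> e - w"
    using T_0_swap [OF u v] uv by (simp add: w_def c_def T_linear)
  have uw: "u \<cdot> w = \<alpha> \<odot> v"
    by (simp add: w_def \<alpha>_def left_alt_T_0 [OF u])
  have "v \<cdot> (v \<cdot> u) = \<beta> \<odot> u"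
    by (simp add: \<beta>_def left_alt_T_0 [OF v])
  then have vw: "v \<cdot> w = c \<odot> v - \<beta> \<odot> u"
    by (simp add: vu mul_linear algebra_simps)
  have wu: "w \<cdot> u = T (w \<cdot> u) \<odot> e - \<alpha> \<odot> v"
    using T_0_swap [OF u w] by (simp add: uw T_linear v)
  have wv: "w \<cdot> v = T (w \<cdot> v) \<odot> e - c \<odot> v + \<beta> \<odot> u"
    using T_0_swap [OF v w] by (simp add: vw T_linear u v diff_diff_eq2 diff_add_eq)
  have "w \<cdot> (w \<cdot> u) = T (w \<cdot> w) \<odot> u"
    by (rule left_alt_T_0 [OF w])
  moreover have "w \<cdot> (w \<cdot> u) = T (w \<cdot> u) \<odot> w - \<alpha> \<odot> (w \<cdot> v)"
    by (subst wu) (simp add: mul_linear)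
  ultimately have *: "T (w \<cdot> u) \<odot> w = T (w \<cdot> w) \<odot> u + \<alpha> \<odot> (T (w \<cdot> v) \<odot> e - c \<odot> v + \<beta> \<odot> u)"
    by (subst (asm) wv) (simp add: algebra_simps)
  have "\<alpha> * T (w \<cdot> v) = 0"
    using arg_cong [OF *, of T] by (simp add: T_linear u v w)
  then have wv0: "T (w \<cdot> v) = 0"
    using \<alpha>0 by simp
  have "T (w \<cdot> w) * \<alpha> + \<alpha> * (\<beta> * \<alpha>) = 0"
    using arg_cong [OF *, of "\<lambda>x. T (u \<cdot> x)"] uv
    by (simp add: mul_linear T_linear uw u v wv0 flip: \<alpha>_def)
  then have "(T (w \<cdot> w) + \<alpha> * \<beta>) * \<alpha> = 0"
    by (simp add: algebra_simps)
  then have ww: "T (w \<cdot> w) = - \<alpha> * \<beta>"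
    using \<alpha>0 by (simp add: add_eq_0_iff2)
  \<comment> \<open>The terms in \<open>v\<close> and \<open>u\<close> inside the bracket cancel,
    leaving \<open>T (w \<cdot> w) * c = 0\<close>, that is, \<alpha>\<beta>c = 0.\<close>
  have "\<alpha> = 0 \<or> c = 0 \<or> \<beta> = 0"
    using arg_cong [OF *, of "\<lambda>x. T (v \<cdot> x)"]
    by (simp add: mul_linear T_linear vw u v wv0 ww disj_ac flip: c_def \<beta>_def)
  then show ?thesis
    using \<alpha>0 \<beta>0 by (simp add: c_def)
qed simp

lemma T_sym: "T (a \<cdot> b) = T (b \<cdot> a)"
proof -
  have pure: "T (u \<cdot> v) = T (v \<cdot> u)" if u: "T u = 0" and v: "T v = 0" for u v
  proof (cases "u = 0")
    case False
    then have u0: "T (u \<cdot> u) \<noteq> 0"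
      using T_square_0 [of u 0] u by auto
    \<comment> \<open>One Gram-Schmidt step, reducing to the orthogonal case.\<close>
    define k where "k = T (u \<cdot> v) / T (u \<cdot> u)"
    have "T ((v - k \<odot> u) \<cdot> u) = 0"
      by (rule T_sym_orthogonal) (use u v False u0 in \<open>simp_all add: T_linear mul_linear k_def\<close>)
    then show ?thesis
      using u0 by (simp add: T_linear mul_linear k_def)
  qed simp
  show ?thesis
    using pure [of "a - T a \<odot> e" "b - T b \<odot> e"] by (simp add: T_linear mul_linear)
qed

text \<open>The trilinear form \<open>T (x \<cdot> (y \<cdot> z))\<close> is alternating on
  trace-zero elements: the last two arguments anticommute up to a scalar, and the first two change
  sign by linearised left alternativity. Symmetry of \<open>T\<close> then reduces the claim to
  three transpositions.\<close>

lemma T_triple: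
  assumes "T u = 0" "T b = 0" "T c = 0"
  shows "T ((u \<cdot> b) \<cdot> c) = - T (b \<cdot> (u \<cdot> c))"
proof -
  have swap: "T (x \<cdot> (y \<cdot> z)) = - T (x \<cdot> (z \<cdot> y))" if "T x = 0" "T y = 0" "T z = 0" for x y z
    by (subst T_0_swap [of z y]) (simp_all add: mul_linear T_linear that)
  have zero: "T (x \<cdot> (x \<cdot> z)) = 0" if "T x = 0" "T z = 0" for x z
    using that by (simp add: left_alt_T_0 T_smul)
  have swap': "T (x \<cdot> (y \<cdot> z)) = - T (y \<cdot> (x \<cdot> z))" if "T x = 0" "T y = 0" "T z = 0" for x y z
    using zero [of "x + y" z] zero [of x z] zero [of y z] that
    by (simp add: mul_add_left mul_add_right T_add eq_neg_iff_add_eq_0 add_ac)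
  have "T ((u \<cdot> b) \<cdot> c) = T (c \<cdot> (u \<cdot> b))"
    by (rule T_sym)
  also have "\<dots> = - T (c \<cdot> (b \<cdot> u))"
    using assms by (intro swap)
  also have "\<dots> = T (b \<cdot> (c \<cdot> u))"
    using assms swap' [of c b u] by simp
  also have "\<dots> = - T (b \<cdot> (u \<cdot> c))"
    using assms by (intro swap)
  finally show ?thesis .
qed

text \<open>By \<open>square_eq\<close>, \<open>N a a\<close> is the constant term n of the
  quadratic equation a^2 - 2 T(a) a + n e = 0.\<close>

definition N :: "'a \<Rightarrow> 'a \<Rightarrow> 'f" where
  "N a b = 2 * T a * T b - T (a \<cdot> b)"

text \<open>After splitting off the scalar parts of all three elements, the only term that is not
  immediate is \<open>T_triple\<close>.\<close>

lemma N_adjoint: "N (a \<cdot> b) c = N b (((2 * T a) \<odot> e - a) \<cdot> c)"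
proof -
  have *: "N ((u + r \<odot> e) \<cdot> (v + s \<odot> e)) (w + t \<odot> e)
      = N (v + s \<odot> e) (((2 * T (u + r \<odot> e)) \<odot> e - (u + r \<odot> e)) \<cdot> (w + t \<odot> e))"
    if "T u = 0" "T v = 0" "T w = 0" for u v w r s t
    using that by (simp add: N_def T_linear mul_linear T_triple T_sym [of v u] algebra_simps)
  show ?thesis
    using * [of "a - T a \<odot> e" "b - T b \<odot> e" "c - T c \<odot> e" "T a" "T b" "T c"]
    by (simp add: T_linear)
qed

sublocale anisotropic_composition_algebra smul mul e N
proof
  show anisotropic: "a = 0" if "N a a = 0" for a
  proof -
    have "T (a - T a \<odot> e) = 0"
      by (simp add: T_linear)
    moreover have "T ((a - T a \<odot> e) \<cdot> (a - T a \<odot> e)) = T a * T a"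
      using that by (simp add: N_def T_linear mul_linear algebra_simps)
    ultimately have a: "a - T a \<odot> e = 0"
      by (rule T_square_0)
    have "T a * T a = 0"
      using arg_cong [OF a, of "\<lambda>x. T (x \<cdot> a)"] that by (simp add: N_def T_linear mul_linear)
    then show ?thesis
      using a by simp
  qed
  show "a = 0" if "\<And>b. N a b = 0" for a
    using that [of a] by (rule anisotropic)
  show "N a b = N b a" for a b
    by (simp add: N_def T_sym [of a b])
  show "N (a + b) c = N a c + N b c" for a b c
    by (simp add: N_def T_linear mul_linear algebra_simps)
  show "N (r \<odot> a) b = r * N a b" for r a b
    by (simp add: N_def T_linear mul_linear algebra_simps)
  show "N (a \<cdot> b) (a \<cdot> b) = N a a * N b b" for a b
  proof -
    \<comment> \<open>The adjoint of left multiplication by \<open>a\<close>, applied to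
      \<open>a \<cdot> b\<close>; it must be the multiple \<open>N a a\<close> of
      \<open>b\<close>.\<close>
    have "((2 * T a) \<odot> e - a) \<cdot> (a \<cdot> b) = ((2 * T a) \<odot> a - a \<cdot> a) \<cdot> b"
      by (simp add: mul_linear left_alt)
    also have "\<dots> = N a a \<odot> b"
      by (subst square_eq) (simp add: mul_linear N_def)
    finally show ?thesis
      by (simp add: N_adjoint) (simp add: N_def T_linear mul_linear algebra_simps)
  qed
qed (use two_neq_0 in simp_all)

end

section \<open>Coordinate models and the classification\<close>

lemma vector_space_self: "vector_space ((*) :: 'f::field \<Rightarrow> 'f \<Rightarrow> 'f)"
  by unfold_locales (simp_all add: algebra_simps)

lemma vector_space_doubling:
  assumes "vector_space sm"
  shows "vector_space (doubling_smul sm)"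
proof -
  interpret vector_space sm by fact
  show ?thesis
    by unfold_locales (auto simp: algebra_simps)
qed

text \<open>The hypothesis makes the norm x^2 - \<alpha> y^2 anisotropic, so that conjugate over
  norm is an inverse.\<close>

lemma quadratic_field_extension_doubling:
  fixes \<alpha> :: "'f::field"
  assumes nonsquare: "\<And>a b. a * a = \<alpha> * (b * b) \<Longrightarrow> b = 0"
  shows "quadratic_field_extension (doubling_smul (*)) (doubling_mul (*) (*) id \<alpha>)"
proof -
  interpret K: vector_space "doubling_smul ((*) :: 'f \<Rightarrow> _)"
    by (intro vector_space_doubling vector_space_self)
  have "nonassoc_algebra (doubling_smul (*)) (doubling_mul (*) (*) id \<alpha>)"
    by unfold_locales (auto simp: algebra_simps zero_prod_def intro: exI [of _ 1])
  moreover have "associative (doubling_mul (*) (*) id \<alpha>)"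
    by (auto simp: associative_def algebra_simps)
  moreover have "commutative (doubling_mul (*) (*) id \<alpha>)"
    by (auto simp: commutative_def algebra_simps)
  moreover have "two_sided_identity (doubling_mul (*) (*) id \<alpha>) (1, 0)"
    by (auto simp: two_sided_identity_def left_identity_def right_identity_def)
  moreover have "\<exists>b. doubling_mul (*) (*) id \<alpha> a b = (1, 0)" if "a \<noteq> 0" for a
  proof -
    obtain x y where a: "a = (x, y)"
      by fastforce
    define d where "d = x * x - \<alpha> * (y * y)"
    have "d \<noteq> 0"
    proof
      assume "d = 0"
      then have xy: "x * x = \<alpha> * (y * y)"
        by (simp add: d_def)
      then have "y = 0"
        by (rule nonsquare)
      then show False
        using xy that by (simp add: a zero_prod_def)
    qed
    then have "x * x / d - \<alpha> * (y * y) / d = 1"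
      by (simp add: d_def flip: diff_divide_distrib)
    then have "doubling_mul (*) (*) id \<alpha> a (x / d, - y / d) = (1, 0)"
      by (simp add: a mult.assoc)
    then show ?thesis
      by blast
  qed
  moreover have "K.dim UNIV = 2"
  proof -
    have "K.independent {(1, 0), (0, 1)}"
      by (auto simp: K.dependent_finite zero_prod_def)
    moreover have "(a, b) \<in> K.span {(1, 0), (0, 1)}" for a b
    proof -
      have "doubling_smul (*) a (1, 0) + doubling_smul (*) b (0, 1) \<in> K.span {(1, 0), (0, 1)}"
        by (intro K.span_add K.span_scale K.span_base) auto
      then show ?thesis
        by simp
    qed
    ultimately show ?thesis
      by (intro K.dim_unique [of "{(1, 0), (0, 1)}"]) auto
  qed
  ultimately show ?thesis
    unfolding quadratic_field_extension_def by (metis zero_prod_def fst_conv zero_neq_one)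
qed

text \<open>
  Coordinates with respect to $1, p, q, pq$ where $p^2 = \alpha$ and $q^2 = \beta$.
\<close>

definition quat_smul :: "'f::field \<Rightarrow> 'f \<times> 'f \<times> 'f \<times> 'f \<Rightarrow> 'f \<times> 'f \<times> 'f \<times> 'f" where
  "quat_smul r = (\<lambda>(a, b, c, d). (r * a, r * b, r * c, r * d))"

definition quat_mul ::
  "'f::field \<Rightarrow> 'f \<Rightarrow> 'f \<times> 'f \<times> 'f \<times> 'f \<Rightarrow> 'f \<times> 'f \<times> 'f \<times> 'f \<Rightarrow> 'f \<times> 'f \<times> 'f \<times> 'f" where
  "quat_mul \<alpha> \<beta> = (\<lambda>(a0, a1, a2, a3) (b0, b1, b2, b3).
     (a0 * b0 + \<alpha> * (a1 * b1) + \<beta> * (a2 * b2) - \<alpha> * \<beta> * (a3 * b3),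
      a0 * b1 + a1 * b0 + \<beta> * (a3 * b2 - a2 * b3),
      a0 * b2 + a2 * b0 + \<alpha> * (a1 * b3 - a3 * b1),
      a0 * b3 + a3 * b0 + a1 * b2 - a2 * b1))"

definition quat_star :: "'f::field \<times> 'f \<times> 'f \<times> 'f \<Rightarrow> 'f \<times> 'f \<times> 'f \<times> 'f" where
  "quat_star = (\<lambda>(a, b, c, d). (a, - b, - c, - d))"

lemma quat_simps [simp]:
  "quat_smul r (a, b, c, d) = (r * a, r * b, r * c, r * d)"
  "quat_mul \<alpha> \<beta> (a0, a1, a2, a3) (b0, b1, b2, b3) =
     (a0 * b0 + \<alpha> * (a1 * b1) + \<beta> * (a2 * b2) - \<alpha> * \<beta> * (a3 * b3),
      a0 * b1 + a1 * b0 + \<beta> * (a3 * b2 - a2 * b3),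
      a0 * b2 + a2 * b0 + \<alpha> * (a1 * b3 - a3 * b1),
      a0 * b3 + a3 * b0 + a1 * b2 - a2 * b1)"
  "quat_star (a, b, c, d) = (a, - b, - c, - d)"
  by (simp_all add: quat_smul_def quat_mul_def quat_star_def)

lemma vector_space_quat: "vector_space quat_smul"
  by unfold_locales (auto simp: algebra_simps)

lemma quaternion_basis_quat:
  fixes \<alpha> \<beta> :: "'f::field"
  assumes "\<alpha> \<noteq> 0" "\<beta> \<noteq> 0"
  shows "quaternion_basis quat_smul (quat_mul \<alpha> \<beta>) (1, 0, 0, 0) (0, 1, 0, 0) (0, 0, 1, 0)"
proof -
  interpret Q: vector_space "quat_smul :: 'f \<Rightarrow> _"
    by (rule vector_space_quat)
  let ?B = "{(1, 0, 0, 0), (0, 1, 0, 0), (0, 0, 1, 0), (0, 0, 0, 1)} :: ('f \<times> 'f \<times> 'f \<times> 'f) set"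
  have "Q.independent ?B"
    by (auto simp: Q.dependent_finite zero_prod_def)
  moreover have "(a, b, c, d) \<in> Q.span ?B" for a b c d
  proof -
    have "quat_smul a (1, 0, 0, 0) + (quat_smul b (0, 1, 0, 0) +
        (quat_smul c (0, 0, 1, 0) + quat_smul d (0, 0, 0, 1))) \<in> Q.span ?B"
      by (intro Q.span_add Q.span_scale Q.span_base) auto
    then show ?thesis
      by simp
  qed
  ultimately show ?thesis
    using assms
    by (auto simp: quaternion_basis_def two_sided_identity_def left_identity_def right_identity_def)
qed

lemma quaternion_algebra_quat:
  assumes "\<alpha> \<noteq> 0" "\<beta> \<noteq> 0"
  shows "quaternion_algebra quat_smul (quat_mul \<alpha> \<beta>)"
proof -
  have "nonassoc_algebra quat_smul (quat_mul \<alpha> \<beta>)"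
  proof -
    interpret vector_space quat_smul
      by (rule vector_space_quat)
    show ?thesis
      by unfold_locales (auto simp: algebra_simps zero_prod_def intro: exI [of _ 1])
  qed
  moreover have "associative (quat_mul \<alpha> \<beta>)"
    by (auto simp: associative_def algebra_simps)
  ultimately show ?thesis
    using quaternion_basis_quat [OF assms] unfolding quaternion_algebra_def by blast
qed

lemma standard_involution_quat:
  assumes "\<alpha> \<noteq> 0" "\<beta> \<noteq> 0"
  shows "standard_involution quat_smul (quat_mul \<alpha> \<beta>) quat_star"
proof -
  have "Vector_Spaces.linear quat_smul quat_smul quat_star"
    by (auto simp: Vector_Spaces.linear_iff vector_space_quat)
  then show ?thesis
    using quaternion_basis_quat [OF assms] unfolding standard_involution_def by fastforce
qed

section \<open>The doubling chain from the scalars to dimension eight\<close>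

context anisotropic_composition_algebra
begin

lemma embedding_surj_imp_isomorphic:
  assumes emb: "embedding sm m star \<psi>" and "surj \<psi>" and "vector_space sm"
  shows "algebra_isomorphic smul mul sm m"
proof -
  have bij: "bij \<psi>"
    using embeddingD(1) [OF emb] assms(2) by (rule bijI)
  have inv [simp]: "inv \<psi> (\<psi> x) = x" "\<psi> (inv \<psi> y) = y" for x y
    using bij by (simp_all add: bij_def surj_f_inv_f)
  have inv_eqI: "inv \<psi> x = y" if "\<psi> y = x" for x y
    using that inv(1) by blast
  have "Vector_Spaces.linear smul sm (inv \<psi>)"
    unfolding Vector_Spaces.linear_iff
    by (auto intro!: inv_eqI simp: embeddingD(3,4) [OF emb] assms(3) vector_space_axioms)
  moreover have "inv \<psi> (x \<cdot> y) = m (inv \<psi> x) (inv \<psi> y)" for x y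
    by (rule inv_eqI) (simp add: embeddingD(5) [OF emb])
  ultimately show ?thesis
    unfolding algebra_isomorphic_def using bij_imp_bij_inv [OF bij] by blast
qed

lemma embedding_scalar: "embedding (*) (*) id (\<lambda>r. r \<odot> e)"
  unfolding embedding_def
proof (intro conjI allI)
  show "inj (\<lambda>r. r \<odot> e)"
    using e_neq_0 by (auto simp: inj_def)
  show "e \<in> range (\<lambda>r. r \<odot> e)"
    using scale_one [of e] by (metis rangeI)
  show "\<exists>b. \<forall>c. N (x - b \<odot> e) (c \<odot> e) = 0" for x
    by (rule exI [of _ "N x e"]) (simp add: N_linear)
  show "id x \<odot> e = bar (x \<odot> e)" for x
    by (simp add: bar_def N_linear smul_double)
qed (simp_all add: mul_linear scale_left_distrib)

text \<open>Two doublings of the scalars live on pairs of pairs; this regroups the coordinates to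
  the carrier on which the quaternion model is defined.\<close>

lemma embedding_quat:
  assumes "embedding (doubling_smul (doubling_smul (*)))
      (doubling_mul (doubling_smul (*)) (doubling_mul (*) (*) id \<alpha>) (\<lambda>(x, y). (id x, - y)) \<beta>)
      (\<lambda>(x, y). ((case x of (x, y) \<Rightarrow> (id x, - y)), - y)) \<psi>"
  shows "embedding quat_smul (quat_mul \<alpha> \<beta>) quat_star (\<lambda>(a, b, c, d). \<psi> ((a, b), (c, d)))"
  unfolding embedding_def
proof (intro conjI allI)
  let ?\<psi> = "\<lambda>(a, b, c, d). \<psi> ((a, b), (c, d))"
  show "inj ?\<psi>"
    using embeddingD(1) [OF assms] by (auto simp: inj_def)
  show "e \<in> range ?\<psi>"
    using embeddingD(2) [OF assms] by (force simp: image_iff)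
  fix x y :: "'f \<times> 'f \<times> 'f \<times> 'f" and r
  obtain a0 a1 a2 a3 where x: "x = (a0, a1, a2, a3)"
    by (metis prod.collapse)
  obtain b0 b1 b2 b3 where y: "y = (b0, b1, b2, b3)"
    by (metis prod.collapse)
  show "?\<psi> (x + y) = ?\<psi> x + ?\<psi> y"
    using embeddingD(3) [OF assms, of "((a0, a1), (a2, a3))" "((b0, b1), (b2, b3))"] by (simp add: x y)
  show "?\<psi> (quat_smul r x) = r \<odot> ?\<psi> x"
    using embeddingD(4) [OF assms, of r "((a0, a1), (a2, a3))"] by (simp add: x)
  show "?\<psi> (quat_mul \<alpha> \<beta> x y) = ?\<psi> x \<cdot> ?\<psi> y"
    using embeddingD(5) [OF assms, of "((a0, a1), (a2, a3))" "((b0, b1), (b2, b3))"]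
    by (simp add: x y algebra_simps)
  show "?\<psi> (quat_star x) = bar (?\<psi> x)"
    using embeddingD(6) [OF assms, of "((a0, a1), (a2, a3))"] by (simp add: x)
next
  fix x
  obtain b where "\<forall>c. N (x - \<psi> b) (\<psi> c) = 0"
    using embeddingD(7) [OF assms] by blast
  moreover obtain b0 b1 b2 b3 where "b = ((b0, b1), (b2, b3))"
    by (metis prod.collapse)
  ultimately show "\<exists>b. \<forall>c. N (x - (case b of (a, b, c, d) \<Rightarrow> \<psi> ((a, b), (c, d))))
      (case c of (a, b, c, d) \<Rightarrow> \<psi> ((a, b), (c, d))) = 0"
    by (intro exI [of _ "(b0, b1, b2, b3)"]) auto
qed

theorem classification: "isomorphic_to_F_or_quadratic_or_quaternion_or_octonion smul mul"
proof (cases "surj (\<lambda>r. r \<odot> e)")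
  case True
  show ?thesis
    using embedding_surj_imp_isomorphic [OF embedding_scalar True vector_space_self]
    unfolding isomorphic_to_F_or_quadratic_or_quaternion_or_octonion_def by blast
next
  case False
  obtain u where u: "u \<noteq> 0" "\<And>c. N u (c \<odot> e) = 0"
    using exists_orthogonal [OF embedding_scalar False] by blast
  define \<alpha> where "\<alpha> = - N u u"
  note emb1 = embedding_doubling [OF embedding_scalar u, folded \<alpha>_def]
  have ue: "N u e = 0"
    using u(2) [of 1] by simp
  have nonsquare: "b = 0" if "a * a = \<alpha> * (b * b)" for a b
  proof -
    \<comment> \<open>The norm of this vector is a^2 - \<alpha> b^2, because \<open>u\<close> is
      orthogonal to \<open>e\<close> and \<alpha> = \<open>- N u u\<close>.\<close>
    have "N (a \<odot> e + b \<odot> u) (a \<odot> e + b \<odot> u) = 0"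
      using that ue by (simp add: N_linear N_sym [of e u] \<alpha>_def algebra_simps)
    then have *: "a \<odot> e + b \<odot> u = 0"
      by (rule N_anisotropic)
    then have "N (a \<odot> e + b \<odot> u) u = 0"
      by simp
    then show ?thesis
      using ue N_anisotropic [of u] u(1) by (auto simp: N_linear N_sym [of e u])
  qed
  show ?thesis
  proof (cases "surj (\<lambda>(x, y). x \<odot> e + y \<odot> e \<cdot> u)")
    case True
    then have "algebra_isomorphic smul mul (doubling_smul (*)) (doubling_mul (*) (*) id \<alpha>)"
      using embedding_surj_imp_isomorphic [OF emb1] vector_space_doubling [OF vector_space_self] by blast
    moreover have "quadratic_field_extension (doubling_smul (*)) (doubling_mul (*) (*) id \<alpha>)"
      by (rule quadratic_field_extension_doubling) (rule nonsquare)
    ultimately show ?thesis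
      unfolding isomorphic_to_F_or_quadratic_or_quaternion_or_octonion_def by blast
  next
    case False
    obtain v where v: "v \<noteq> 0" "\<And>c. N v (case c of (x, y) \<Rightarrow> x \<odot> e + y \<odot> e \<cdot> u) = 0"
      using exists_orthogonal [OF emb1 False] by blast
    define \<beta> where "\<beta> = - N v v"
    have \<alpha>\<beta>: "\<alpha> \<noteq> 0" "\<beta> \<noteq> 0"
      using u(1) v(1) N_anisotropic by (auto simp: \<alpha>_def \<beta>_def)
    obtain \<psi> where emb2: "embedding quat_smul (quat_mul \<alpha> \<beta>) quat_star \<psi>"
      using embedding_quat [OF embedding_doubling [OF emb1 v, folded \<beta>_def]] by blast
    show ?thesis
    proof (cases "surj \<psi>")
      case True
      then have "algebra_isomorphic smul mul quat_smul (quat_mul \<alpha> \<beta>)"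
        using embedding_surj_imp_isomorphic [OF emb2] vector_space_quat by blast
      then show ?thesis
        using quaternion_algebra_quat [OF \<alpha>\<beta>]
        unfolding isomorphic_to_F_or_quadratic_or_quaternion_or_octonion_def by blast
    next
      case False
      obtain w where w: "w \<noteq> 0" "\<And>c. N w (\<psi> c) = 0"
        using exists_orthogonal [OF emb2 False] by blast
      define \<gamma> where "\<gamma> = - N w w"
      have \<gamma>: "\<gamma> \<noteq> 0"
        using w(1) N_anisotropic by (auto simp: \<gamma>_def)
      let ?sm = "doubling_smul quat_smul" and ?m = "doubling_mul quat_smul (quat_mul \<alpha> \<beta>) quat_star \<gamma>"
      let ?\<psi> = "\<lambda>(x, y). \<psi> x + \<psi> y \<cdot> w"
      note emb3 = embedding_doubling [OF emb2 w, folded \<gamma>_def]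
      have "surj ?\<psi>"
      proof (rule ccontr)
        assume not_surj: "\<not> surj ?\<psi>"
        obtain z where z: "z \<noteq> 0" "\<And>c. N z (?\<psi> c) = 0"
          using exists_orthogonal [OF emb3 not_surj] by blast
        note assoc = embedding_proper_imp_assoc [OF emb3 z]
        \<comment> \<open>With l the last generator adjoined, p(ql) = (qp)l by the doubling product,
          whereas associativity would give (pq)l; but qp = -pq.\<close>
        have "(1 :: 'f) = - 1"
          using assoc [of "((0, 1, 0, 0), 0)" "((0, 0, 1, 0), 0)" "(0, (1, 0, 0, 0))"]
          by (simp add: zero_prod_def)
        then show False
          using two_neq_0 by (metis add.right_inverse one_add_one)
      qed
      then have "algebra_isomorphic smul mul ?sm ?m"
        using embedding_surj_imp_isomorphic [OF emb3] vector_space_doubling [OF vector_space_quat] by blast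
      moreover have "octonion_algebra ?sm ?m"
        unfolding octonion_algebra_def
        using quaternion_algebra_quat [OF \<alpha>\<beta>] standard_involution_quat [OF \<alpha>\<beta>] \<gamma> by blast
      ultimately show ?thesis
        unfolding isomorphic_to_F_or_quadratic_or_quaternion_or_octonion_def by blast
    qed
  qed
qed

end

section \<open>Extracting the quadratic equation and \<open>square_scalar\<close> from the
  hypotheses of (i)\<close>

context nonassoc_algebra
begin

lemma subalgebra_generated: "subalgebra smul mul (generated_subalgebra smul mul S)"
  unfolding generated_subalgebra_def
  by (rule hull_in) (auto simp: subalgebra_def intro: subspace_Inter)

lemma generated_subalgebra_superset: "S \<subseteq> generated_subalgebra smul mul S"
  unfolding generated_subalgebra_def by (rule hull_subset)

text \<open>For non-scalar \<open>a\<close>, a square outside the span of \<open>a\<close> and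
  \<open>e\<close> would give three independent vectors in a space spanned by at most two.\<close>

lemma quadratic_square:
  assumes e: "e \<noteq> 0" "left_identity mul e"
    and "finite B" "card B \<le> 2" and B: "generated_subalgebra smul mul {e, a} \<subseteq> span B"
  shows "\<exists>s t. a \<cdot> a = s \<odot> a + t \<odot> e"
proof (cases "a \<in> span {e}")
  case True
  then obtain c where "a = c \<odot> e"
    by (auto simp: span_singleton)
  then have "a \<cdot> a = c \<odot> a + 0 \<odot> e"
    using e by (simp add: mul_smul_left left_identity_def)
  then show ?thesis
    by blast
next
  case False
  have "a \<cdot> a \<in> span {a, e}"
  proof (rule ccontr)
    assume aa: "a \<cdot> a \<notin> span {a, e}"
    have "independent {a \<cdot> a, a, e}"
      using aa False e(1) by (simp add: independent_insert)
    moreover have "{a \<cdot> a, a, e} \<subseteq> span B"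
      using B generated_subalgebra_superset [of "{e, a}"] subalgebra_generated [of "{e, a}"]
      by (auto simp: subalgebra_def)
    ultimately have "card {a \<cdot> a, a, e} \<le> 2"
      using independent_span_bound \<open>finite B\<close> \<open>card B \<le> 2\<close> by (metis order.trans)
    moreover have "a \<noteq> e" "a \<cdot> a \<noteq> a" "a \<cdot> a \<noteq> e"
      using aa False span_base [of _ "{a, e}"] span_base [of e "{e}"] by auto
    ultimately show False
      by simp
  qed
  then obtain s t where "a \<cdot> a - s \<odot> a = t \<odot> e"
    by (auto simp: span_insert [of a] span_singleton)
  then have "a \<cdot> a = s \<odot> a + t \<odot> e"
    by (simp add: diff_eq_eq add.commute)
  then show ?thesis
    by blast
qed

text \<open>The factors of (a - re)(a + re) = 0 must lie in the algebra generated by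
  \<open>a\<close> alone, so \<open>e\<close> has to be found there first. It is a^2 / r^2, where r
  \<noteq> 0 because otherwise a^2 = 0.\<close>

lemma no_zero_divisors_square:
  assumes e: "two_sided_identity mul e"
    and no_zd: "\<And>a. a \<noteq> 0 \<Longrightarrow> no_nontrivial_zero_divisors mul (generated_subalgebra smul mul {a})"
    and square: "a \<cdot> a = (r * r) \<odot> e"
  shows "\<exists>c. a = c \<odot> e"
proof (rule ccontr)
  assume *: "\<nexists>c. a = c \<odot> e"
  have id: "e \<cdot> x = x" "x \<cdot> e = x" for x
    using e by (simp_all add: two_sided_identity_def left_identity_def right_identity_def)
  define G where "G = generated_subalgebra smul mul {a}"
  have sub: "subspace G" and mul: "\<And>x y. x \<in> G \<Longrightarrow> y \<in> G \<Longrightarrow> x \<cdot> y \<in> G" and a: "a \<in> G"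
    using subalgebra_generated [of "{a}"] generated_subalgebra_superset [of "{a}"]
    by (auto simp: G_def subalgebra_def)
  have "a \<noteq> 0"
    using * scale_zero_left [of e] by metis
  then have zd: "x = 0 \<or> y = 0" if "x \<in> G" "y \<in> G" "x \<cdot> y = 0" for x y
    using no_zd [of a] that
    unfolding G_def no_nontrivial_zero_divisors_def zero_divisor_in_def by blast
  have "r \<noteq> 0"
    using zd [OF a a] square \<open>a \<noteq> 0\<close> by auto
  then have "e = inverse (r * r) \<odot> (a \<cdot> a)"
    by (simp add: square del: inverse_mult_distrib)
  then have e: "e \<in> G"
    using mul [OF a a] sub by (metis subspace_scale)
  have "a - r \<odot> e = 0 \<or> a + r \<odot> e = 0"
  proof (rule zd)
    show "a - r \<odot> e \<in> G" "a + r \<odot> e \<in> G"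
      using sub a e by (auto intro: subspace_diff subspace_add subspace_scale)
    show "(a - r \<odot> e) \<cdot> (a + r \<odot> e) = 0"
      by (simp add: mul_linear square id algebra_simps)
  qed
  then have "a = r \<odot> e \<or> a = (- r) \<odot> e"
    by (simp add: eq_neg_iff_add_eq_0)
  then show False
    using * by blast
qed

end

theorem theorem5p10:
  fixes smul :: "'f::field \<Rightarrow> 'a::ab_group_add \<Rightarrow> 'a"
    and mul :: "'a \<Rightarrow> 'a \<Rightarrow> 'a"
  assumes char_not_2: "CHAR('f) \<noteq> 2"
    and alg: "nonassoc_algebra smul mul"
  shows
    "((left_alternative mul \<or> right_alternative mul) \<and>
      quadratic_algebra smul mul \<and>
      (\<forall>a. a \<noteq> 0 \<longrightarrow>
         no_nontrivial_zero_divisors mul (generated_subalgebra smul mul {a}))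
      \<longrightarrow> isomorphic_to_F_or_quadratic_or_quaternion_or_octonion smul mul)
     \<and>
     (\<forall>e form.
       flexible mul \<and>
       (left_identity mul e \<or> right_identity mul e) \<and>
       no_nontrivial_zero_divisors mul UNIV \<and>
       nondegenerate_bilinear_form smul form \<and>
       permits_composition mul form
      \<longrightarrow> isomorphic_to_F_or_quadratic_or_quaternion_or_octonion smul mul)"
proof (intro conjI allI impI; elim conjE)
  interpret A: nonassoc_algebra smul mul by (rule alg)
  have two: "(2::'f) \<noteq> 0"
  proof
    assume "(2::'f) = 0"
    then have "CHAR('f) dvd 2"
      using of_nat_eq_0_iff_char_dvd [of 2, where 'a = 'f] by simp
    then have "CHAR('f) = 1 \<or> CHAR('f) = 2"
      using two_is_prime_nat unfolding prime_nat_iff by blast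
    then show False
      using char_not_2 CHAR_not_1 [where 'a = 'f] by simp
  qed
  show "isomorphic_to_F_or_quadratic_or_quaternion_or_octonion smul mul"
    if alt: "left_alternative mul \<or> right_alternative mul" and quad: "quadratic_algebra smul mul"
      and no_zd: "\<forall>a. a \<noteq> 0 \<longrightarrow> no_nontrivial_zero_divisors mul (generated_subalgebra smul mul {a})"
  proof -
    obtain e where e: "two_sided_identity mul e" and span:
        "\<forall>a. \<exists>B. finite B \<and> card B \<le> 2 \<and> generated_subalgebra smul mul {e, a} \<subseteq> A.span B"
      using quad unfolding quadratic_algebra_def by blast
    have id: "mul e x = x" "mul x e = x" for x
      using e by (simp_all add: two_sided_identity_def left_identity_def right_identity_def)
    have "e \<noteq> 0"
      using A.nonzero_algebra id(1) by (metis A.mul_zero_left)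
    then have square: "\<exists>s t. mul a a = smul s a + smul t e" for a
      using A.quadratic_square [of e] span e unfolding two_sided_identity_def by meson
    have square_scalar: "\<exists>c. a = smul c e" if "mul a a = smul (r * r) e" for a r
      using A.no_zero_divisors_square [OF e _ that] no_zd by blast
    show ?thesis
      using alt
    proof
      assume "left_alternative mul"
      then interpret L: anisotropic_quadratic_left_alternative smul mul e
        by unfold_locales (use two id square square_scalar in \<open>simp_all add: left_alternative_def\<close>)
      show ?thesis
        by (rule L.classification)
    next
      assume "right_alternative mul"
      then interpret R: anisotropic_quadratic_left_alternative smul "\<lambda>a b. mul b a" e
        by unfold_locales
          (use two id square square_scalar A.nonzero_algebra in
            \<open>simp_all add: right_alternative_def A.mul_linear\<close>)
      \<comment> \<open>The norm form of the opposite algebra also permits composition here, since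
        the field is commutative.\<close>
      interpret anisotropic_composition_algebra smul mul e R.N
        by unfold_locales
          (use two id R.N_sym R.N_mul R.N_nondegenerate R.N_anisotropic in
            \<open>simp_all add: R.N_linear mult.commute\<close>)
      show ?thesis
        by (rule classification)
    qed
  qed
  fix e form
  assume flex: "flexible mul" and e: "left_identity mul e \<or> right_identity mul e"
    and no_zd: "no_nontrivial_zero_divisors mul UNIV"
    and form: "nondegenerate_bilinear_form smul form" and comp: "permits_composition mul form"
  have zd: "a = 0 \<or> b = 0" if "mul a b = 0" for a b
    using no_zd that unfolding no_nontrivial_zero_divisors_def zero_divisor_in_def by blast
  have "mul e a = a \<and> mul a e = a" for a
  proof (cases "a = 0")
    case False
    show ?thesis
      using e
    proof
      assume left: "left_identity mul e"
      \<comment> \<open>Flexibility gives (ae)a = a(ea) = aa.\<close>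
      then have "mul (mul a e - a) a = 0"
        using flex by (simp add: A.mul_linear flexible_def left_identity_def)
      from zd [OF this] show ?thesis
        using False left by (auto simp: left_identity_def)
    next
      assume right: "right_identity mul e"
      have "mul a (mul e a) = mul (mul a e) a"
        using flex by (simp add: flexible_def)
      with right have "mul a (mul e a - a) = 0"
        by (simp add: A.mul_diff_right right_identity_def)
      from zd [OF this] show ?thesis
        using False right by (auto simp: right_identity_def)
    qed
  qed simp
  then interpret C: unital_composition_algebra smul mul e form
    using form comp two
    by unfold_locales
      (auto simp: nondegenerate_bilinear_form_def Vector_Spaces.linear_iff permits_composition_def)
  interpret C: anisotropic_composition_algebra smul mul e form
  proof
    \<comment> \<open>An isotropic \<open>a\<close> satisfies \<open>mul (C.bar a) a = 0\<close>; if
      it is the conjugate that vanishes, so does \<open>a\<close>, as conjugation is an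
      involution.\<close>
    show "a = 0" if "form a a = 0" for a
      using C.bar_mul_cancel [of a e] zd [of "C.bar a" a] that C.bar_bar [of a]
      by (auto simp: C.bar_def)
  qed
  show "isomorphic_to_F_or_quadratic_or_quaternion_or_octonion smul mul"
    by (rule C.classification)
qed

end
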